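(* Let $K, L \subset \mathbb{R}^d$ be convex bodies containing the origin in their interiors with $K \subseteq L$, and let $F$ be a linear subspace of $\mathbb{R}^d$. Assume that $K$ is a largest-volume member of $\mathcal{R}_F(K)$ contained in $L$. Then there exist contact pairs $(v_1,p_1),\dots,(v_m,p_m)$ of $K$ and $L$ and positive weights $\alpha_1,\dots,\alpha_m$ such that \[ P_F\Big(\sum_{i=1}^m \alpha_i\, p_i\otimes v_i\Big)P_F = P_F,\quad \sum_{i=1}^m \alpha_i p_i = 0,\quad \operatorname{tr}\Big(\sum_{i=1}^m \alpha_i\, p_i\otimes v_i\Big)=\sum_{i=1}^m\alpha_i = d, \] and \[ \sum_{i=1}^m \alpha_i\, p_i\otimes v_i=\sum_{i=1}^m \alpha_i\, v_i\otimes p_i. \]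
   Context: A convex body is a compact convex set with nonempty interior. For a linear subspace $F\subseteq\mathbb{R}^d$, an $F$-operator is an invertible linear operator $A$ on $\mathbb{R}^d$ such that $F$ and $F^\perp$ are invariant subspaces of $A$ and the restriction of $A$ to $F^\perp$ is a nonzero multiple of the identity on $F^\perp$. For $S\subseteq\mathbb{R}^d$, the rotated positions of $S$ with axis $F$ are $\mathcal{R}_F(S)=\{RAS+z:\ R\in O(d),\ A \text{ an } F\text{-operator},\ z\in\mathbb{R}^d\}$. $P_F$ is orthogonal projection onto $F$. The polar of $S$ is $S^\circ=\{p:\langle x,p\rangle\le1\ \forall x\in S\}$. For convex bodies $K\subseteq L$, a contact pair of $K$ and $L$ is a pair $(v,p)$ with $v\in\partial K\cap\partial L$, $p\in\partial K^\circ\cap\partial L^\circ$, $\langle p,v\rangle=1$. For vectors $p,v$, $p\otimes v$ is the operator $x\mapsto\langle v,x\rangle p$. *)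

theory Defs
  imports "HOL-Analysis.Analysis"
begin

definition convex_body :: "'a::euclidean_space set \<Rightarrow> bool" where
  "convex_body K \<longleftrightarrow> compact K \<and> convex K \<and> interior K \<noteq> {}"

definition F_operator :: "'a::euclidean_space set \<Rightarrow> ('a \<Rightarrow> 'a) \<Rightarrow> bool" where
  "F_operator F A \<longleftrightarrow> linear A \<and> bij A \<and> A ` F \<subseteq> F \<and>
     A ` (orthogonal_comp F) \<subseteq> orthogonal_comp F \<and>
     (\<exists>c. c \<noteq> 0 \<and> (\<forall>x \<in> orthogonal_comp F. A x = c *\<^sub>R x))"

definition rotated_positions :: "'a::euclidean_space set \<Rightarrow> 'a set \<Rightarrow> 'a set set" where
  "rotated_positions F S = {(\<lambda>x. R (A x) + z) ` S | R A z.
      orthogonal_transformation R \<and> F_operator F A}"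

definition orth_proj :: "'a::euclidean_space set \<Rightarrow> 'a \<Rightarrow> 'a" where
  "orth_proj F x = (THE y. y \<in> F \<and> x - y \<in> orthogonal_comp F)"

definition polar :: "'a::euclidean_space set \<Rightarrow> 'a set" where
  "polar S = {p. \<forall>x \<in> S. inner x p \<le> 1}"

definition contact_pair :: "'a::euclidean_space set \<Rightarrow> 'a set \<Rightarrow> 'a \<Rightarrow> 'a \<Rightarrow> bool" where
  "contact_pair K L v p \<longleftrightarrow> v \<in> frontier K \<inter> frontier L \<and>
     p \<in> frontier (polar K) \<inter> frontier (polar L) \<and> inner p v = 1"

definition tensor :: "'a::euclidean_space \<Rightarrow> 'a \<Rightarrow> 'a \<Rightarrow> 'a" where
  "tensor p v = (\<lambda>x. inner v x *\<^sub>R p)"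

definition op_trace :: "('a::euclidean_space \<Rightarrow> 'a) \<Rightarrow> real" where
  "op_trace T = (\<Sum>b\<in>Basis. inner (T b) b)"

end

theory Submission
  imports Defs
begin

text \<open>
  If the required identities have no solution, the target (identity block on \<open>F\<close>, symmetry, centering)
  lies outside the compact convex hull of the data of all contact pairs, and a separating hyperplane
  yields a skew operator \<open>S\<close>, an operator \<open>B\<close> preserving \<open>F\<close> and scalar on its orthogonal
  complement, and a vector \<open>w\<close>, such that \<open>tr B > 0\<close> while \<open>\<langle>p, 2 S v + B v + w\<rangle> < 0\<close> at every contact
  pair. Move \<open>K\<close> by \<open>x \<mapsto> R\<^sub>t (x + t B x) + t w\<close>, where \<open>R\<^sub>t\<close> is the Cayley transform of \<open>t S\<close>: by
  compactness the image stays in \<open>L\<close> for small \<open>t > 0\<close>, and its volume grows at rate \<open>tr B\<close>,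
  contradicting maximality.
\<close>

subsection \<open>Volume and determinants on an abstract Euclidean space\<close>

text \<open>An index type with \<open>DIM('a)\<close> elements identifies \<open>'a\<close> with a space \<open>real ^ 'n\<close>, where the library
  has determinants. The well-order is only there because the library's change-of-volume
  formula demands it.\<close>
typedef (overloaded) 'a basis_index = "{..<DIM('a::euclidean_space)}"
  by (auto intro: exI[of _ 0])

setup_lifting type_definition_basis_index

instantiation basis_index :: (euclidean_space) wellorder
begin

lift_definition less_eq_basis_index :: "'a basis_index \<Rightarrow> 'a basis_index \<Rightarrow> bool" is "(\<le>)" .
lift_definition less_basis_index :: "'a basis_index \<Rightarrow> 'a basis_index \<Rightarrow> bool" is "(<)" .

instance
proof
  fix P :: "'a basis_index \<Rightarrow> bool" and i
  assume step: "\<And>i. (\<And>j. j < i \<Longrightarrow> P j) \<Longrightarrow> P i"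
  show "P i"
    by (induction i rule: measure_induct_rule[of Rep_basis_index])
      (metis step less_basis_index.rep_eq)
qed (transfer; auto)+

end

instance basis_index :: (euclidean_space) finite
proof
  have "(UNIV :: 'a basis_index set) = Abs_basis_index ` {..<DIM('a)}"
    by (rule type_definition.Abs_image[OF type_definition_basis_index, symmetric])
  then show "finite (UNIV :: 'a basis_index set)"
    by (metis finite_imageI finite_lessThan)
qed

definition basis_vec :: "'a::euclidean_space basis_index \<Rightarrow> 'a" where
  "basis_vec = (SOME e. bij_betw e UNIV Basis)"

lemma bij_betw_basis_vec: "bij_betw (basis_vec :: 'a::euclidean_space basis_index \<Rightarrow> 'a) UNIV Basis"
proof -
  have "bij_betw (Rep_basis_index :: 'a basis_index \<Rightarrow> nat) UNIV {..<DIM('a)}"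
    using type_definition.Rep_range[OF type_definition_basis_index]
    by (auto simp: bij_betw_def inj_on_def Rep_basis_index_inject)
  then have "card (UNIV :: 'a basis_index set) = DIM('a)"
    by (simp add: bij_betw_same_card)
  then have "\<exists>e. bij_betw e (UNIV :: 'a basis_index set) (Basis :: 'a set)"
    by (intro finite_same_card_bij) auto
  then show ?thesis
    unfolding basis_vec_def by (rule someI_ex)
qed

lemma basis_vec_in_Basis [simp]: "basis_vec i \<in> Basis"
  using bij_betw_basis_vec bij_betwE by blast

lemma sum_basis_vec: "(\<Sum>i\<in>UNIV. f (basis_vec i)) = (\<Sum>b\<in>Basis. f b)"
  by (rule sum.reindex_bij_betw[OF bij_betw_basis_vec])

lemma prod_basis_vec: "(\<Prod>i\<in>UNIV. f (basis_vec i)) = (\<Prod>b\<in>Basis. f b)"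
  by (rule prod.reindex_bij_betw[OF bij_betw_basis_vec])

lemma inner_basis_vec: "basis_vec i \<bullet> basis_vec j = (if i = j then 1 else 0)"
  using bij_betw_basis_vec by (auto simp: inner_Basis bij_betw_def inj_def)

section \<open>Isometric, volume-preserving coordinates\<close>

definition coords :: "'a::euclidean_space \<Rightarrow> real ^ 'a basis_index" where
  "coords x = (\<chi> i. x \<bullet> basis_vec i)"

definition of_coords :: "real ^ 'a basis_index \<Rightarrow> 'a::euclidean_space" where
  "of_coords v = (\<Sum>i\<in>UNIV. v $ i *\<^sub>R basis_vec i)"

lemma linear_coords: "linear coords"
  by (rule linearI) (auto simp: coords_def vec_eq_iff inner_add_left)

lemma linear_of_coords: "linear of_coords"
  by (rule linearI) (auto simp: of_coords_def sum.distrib scaleR_add_left scaleR_sum_right)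

lemma of_coords_inner_basis_vec [simp]: "of_coords v \<bullet> basis_vec i = v $ i"
  by (simp add: of_coords_def inner_sum_left inner_basis_vec if_distrib cong: if_cong)

lemma coords_of_coords [simp]: "coords (of_coords v) = v"
  by (simp add: coords_def)

lemma of_coords_coords [simp]: "of_coords (coords x) = x"
  unfolding of_coords_def coords_def
  using sum_basis_vec[of "\<lambda>b. (x \<bullet> b) *\<^sub>R b"] by (simp add: euclidean_representation)

lemma norm_coords [simp]: "norm (coords x) = norm x"
proof -
  have "coords x \<bullet> coords x = x \<bullet> x"
    using sum_basis_vec[of "\<lambda>b. (x \<bullet> b) * (x \<bullet> b)"]
    by (simp add: coords_def inner_vec_def euclidean_inner[of x x])
  then show ?thesis by (simp add: norm_eq_sqrt_inner)
qed

lemma norm_of_coords [simp]: "norm (of_coords v) = norm v"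
  by (metis coords_of_coords norm_coords)

text \<open>Lebesgue measure is determined by its values on boxes. Since \<open>basis_vec\<close>
  enumerates \<open>Basis\<close>, the preimage of a box under \<open>of_coords\<close> is the box
  with the same side lengths.\<close>

lemma lborel_distr_of_coords:
  "distr lborel borel (of_coords :: _ \<Rightarrow> 'a::euclidean_space) = lborel"
proof (rule lborel_eqI[symmetric])
  have meas: "(of_coords :: _ \<Rightarrow> 'a) \<in> borel_measurable borel"
    by (intro borel_measurable_continuous_onI linear_continuous_on linear_linear[THEN iffD2] linear_of_coords)
  fix l u :: 'a
  assume le: "\<And>b. b \<in> Basis \<Longrightarrow> l \<bullet> b \<le> u \<bullet> b"
  have Basis_eq: "(Basis :: 'a set) = range basis_vec"
    using bij_betw_basis_vec by (auto simp: bij_betw_def)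
  have "of_coords -` box l u = box (coords l) (coords u)"
    by (simp add: set_eq_iff mem_box_cart(1)) (simp add: mem_box(1) Basis_eq coords_def)
  then have "emeasure (distr lborel borel of_coords) (box l u)
      = emeasure lborel (box (coords l) (coords u))"
    using meas by (subst emeasure_distr) auto
  also have "\<dots> = ennreal (\<Prod>b\<in>Basis. (coords u - coords l) \<bullet> b)"
    by (rule emeasure_lborel_box) (auto simp: Basis_vec_def coords_def inner_axis le)
  also have "(\<Prod>b\<in>Basis. (coords u - coords l) \<bullet> b) = (\<Prod>i\<in>UNIV. (u - l) \<bullet> basis_vec i)"
  proof -
    have eq: "(Basis :: (real ^ 'a basis_index) set) = (\<lambda>i. axis i 1) ` UNIV"
      by (auto simp: Basis_vec_def)
    show ?thesis
      unfolding eq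
      by (subst prod.reindex) (auto simp: inj_on_def axis_eq_axis coords_def inner_axis inner_diff_left)
  qed
  finally show "emeasure (distr lborel borel of_coords) (box l u) = ennreal (\<Prod>b\<in>Basis. (u - l) \<bullet> b)"
    by (simp add: prod_basis_vec)
qed simp

lemma measure_coords_image:
  fixes K :: "'a::euclidean_space set"
  assumes "compact K"
  shows "measure lebesgue (coords ` K) = measure lebesgue K"
proof -
  have cont: "continuous_on S coords" for S :: "'a set"
    by (simp add: linear_continuous_on linear_conv_bounded_linear[symmetric] linear_coords)
  have meas: "(of_coords :: _ \<Rightarrow> 'a) \<in> borel_measurable borel"
    by (intro borel_measurable_continuous_onI linear_continuous_on linear_linear[THEN iffD2] linear_of_coords)
  have "compact (coords ` K)"
    by (intro compact_continuous_image cont assms)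
  have vimage: "coords ` K = of_coords -` K"
    by (auto simp: image_iff) (metis coords_of_coords)
  have K: "K \<in> sets borel"
    using assms by (simp add: borel_compact)
  have "emeasure lborel K = emeasure (distr lborel borel of_coords) K"
    by (simp add: lborel_distr_of_coords)
  also have "\<dots> = emeasure lborel (coords ` K)"
    unfolding vimage using meas K by (subst emeasure_distr) auto
  finally have "measure lborel K = measure lborel (coords ` K)"
    by (simp add: measure_def)
  then show ?thesis
    using K \<open>compact (coords ` K)\<close> by (simp add: borel_compact)
qed

lemma compact_image_linear:
  fixes f :: "'a::euclidean_space \<Rightarrow> 'b::real_normed_vector"
  assumes "linear f" and "compact S"
  shows "compact (f ` S)"
  using assms by (intro compact_continuous_image linear_continuous_on)
    (auto simp: linear_conv_bounded_linear)

section \<open>Determinants as volume factors\<close>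

definition op_matrix :: "('a::euclidean_space \<Rightarrow> 'a) \<Rightarrow> real ^ 'a basis_index ^ 'a basis_index" where
  "op_matrix f = (\<chi> i j. f (basis_vec j) \<bullet> basis_vec i)"

lemma matrix_coords_conj:
  "matrix (\<lambda>v. coords (f (of_coords v))) = op_matrix f"
proof -
  have "of_coords (axis j 1) = basis_vec j" for j :: "'a basis_index"
    by (simp add: of_coords_def axis_def if_distrib[of "\<lambda>c. c *\<^sub>R _"] cong: if_cong)
  then show ?thesis
    by (simp add: matrix_def op_matrix_def coords_def vec_eq_iff)
qed

text \<open>Conjugation by the coordinates turns \<open>f\<close> into a map with matrix
  \<open>op_matrix f\<close> and changes no volume, so the formula for \<open>real ^ 'n\<close>
  carries over.\<close>

lemma measure_linear_image_det:
  fixes f :: "'a::euclidean_space \<Rightarrow> 'a"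
  assumes "linear f" and "compact K"
  shows "measure lebesgue (f ` K) = \<bar>det (op_matrix f)\<bar> * measure lebesgue K"
proof -
  let ?g = "\<lambda>v. coords (f (of_coords v))"
  have lin: "linear ?g"
    using linear_compose[OF linear_compose[OF linear_of_coords assms(1)] linear_coords]
    by (simp add: o_def)
  have cK: "compact (coords ` K)" "compact (f ` K)"
    using assms by (auto intro!: compact_image_linear linear_coords)
  have "?g ` (coords ` K) = coords ` (f ` K)"
    by (simp add: image_image)
  then have "measure lebesgue (f ` K) = measure lebesgue (?g ` (coords ` K))"
    by (simp add: measure_coords_image[OF cK(2)])
  also have "\<dots> = \<bar>det (op_matrix f)\<bar> * measure lebesgue (coords ` K)"
    by (subst measure_linear_image[OF lin])
      (auto simp: matrix_coords_conj lmeasurable_compact cK)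
  finally show ?thesis
    by (simp add: measure_coords_image[OF assms(2)])
qed

lemma measure_orthogonal_transformation_image:
  fixes f :: "'a::euclidean_space \<Rightarrow> 'a"
  assumes "orthogonal_transformation f" and "compact K"
  shows "measure lebesgue (f ` K) = measure lebesgue K"
proof -
  have lf: "linear f"
    using assms(1) by (rule orthogonal_transformation_linear)
  have "linear (\<lambda>v. coords (f (of_coords v)))"
    using linear_compose[OF linear_compose[OF linear_of_coords lf] linear_coords]
    by (simp add: o_def)
  then have "orthogonal_transformation (\<lambda>v. coords (f (of_coords v)))"
    using assms(1) by (simp add: orthogonal_transformation)
  then have "\<bar>det (op_matrix f)\<bar> = 1"
    using orthogonal_transformation_det by (metis matrix_coords_conj)
  then show ?thesis
    by (simp add: measure_linear_image_det[OF lf assms(2)])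
qed

text \<open>The Leibniz expansion is differentiated term by term. At \<open>t = 0\<close> only the
  identity permutation contributes, and its product rule gives the sum of the diagonal
  entries.\<close>

lemma det_mat_1_add_derivative:
  fixes B :: "real ^ 'n ^ 'n"
  shows "((\<lambda>t. det (mat 1 + t *\<^sub>R B)) has_real_derivative trace B) (at 0)"
proof -
  let ?f = "\<lambda>p i t. (mat 1 + t *\<^sub>R B) $ i $ p i"
  let ?D = "\<lambda>p. of_int (sign p) * (\<Sum>i\<in>UNIV. B $ i $ p i * (\<Prod>k\<in>UNIV - {i}. (mat 1 :: real ^ 'n ^ 'n) $ k $ p k))"
  have D: "((\<lambda>t. \<Sum>p | p permutes UNIV. of_int (sign p) * (\<Prod>i\<in>UNIV. ?f p i t))
      has_real_derivative (\<Sum>p | p permutes (UNIV :: 'n set). ?D p)) (at 0)"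
  proof (intro DERIV_sum DERIV_cmult)
    fix p
    have "((\<lambda>t. ?f p i t) has_real_derivative B $ i $ p i) (at 0)" for i
      by (auto intro!: derivative_eq_intros)
    from has_field_derivative_prod[of UNIV "?f p", OF this]
    show "((\<lambda>t. \<Prod>i\<in>UNIV. ?f p i t) has_real_derivative
        (\<Sum>i\<in>UNIV. B $ i $ p i * (\<Prod>k\<in>UNIV - {i}. (mat 1 :: real ^ 'n ^ 'n) $ k $ p k))) (at 0)"
      by simp
  qed
  have zero: "?D p = 0" if p: "p permutes (UNIV :: 'n set)" and "p \<noteq> id" for p
  proof -
    obtain a where a: "p a \<noteq> a"
      using \<open>p \<noteq> id\<close> by (auto simp: fun_eq_iff)
    \<comment> \<open>A permutation other than the identity moves at least two indices, here
      \<open>a\<close> and \<open>p a\<close>. After one factor is removed by the product rule, an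
      off-diagonal zero of the identity matrix still remains.\<close>
    have pa: "p (p a) \<noteq> p a"
      using a permutes_inj[OF p] by (auto dest: injD)
    have "(\<Prod>k\<in>UNIV - {i}. (mat 1 :: real ^ 'n ^ 'n) $ k $ p k) = 0" for i
    proof (cases "i = a")
      case True
      with a pa show ?thesis by (intro prod_zero) (auto simp: mat_def intro!: bexI[of _ "p a"])
    next
      case False
      with a show ?thesis by (intro prod_zero) (auto simp: mat_def intro!: bexI[of _ a])
    qed
    then show ?thesis by (simp only: mult_zero_right sum.neutral_const)
  qed
  have "(\<Sum>p | p permutes (UNIV :: 'n set). ?D p) = (\<Sum>p\<in>{id}. ?D p)"
    by (rule sum.mono_neutral_right) (use zero in \<open>auto simp: permutes_id finite_permutations simp del: scaleR_zero_left\<close>)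
  also have "\<dots> = trace B"
    by (simp add: mat_def trace_def sign_id)
  finally show ?thesis
    using D by (simp add: det_def)
qed

subsection \<open>First-order perturbation of a position\<close>

lemma compact_polar:
  fixes L :: "'a::euclidean_space set"
  assumes "0 \<in> interior L"
  shows "compact (polar L)"
proof -
  obtain e where e: "e > 0" "cball 0 e \<subseteq> L"
    using assms mem_interior_cball by blast
  have "norm p \<le> 1 / e" if "p \<in> polar L" for p
  proof (cases "p = 0")
    case False
    \<comment> \<open>Testing \<open>p\<close> against the point of length \<open>e\<close> in its
      own direction bounds its norm.\<close>
    have "(e / norm p) *\<^sub>R p \<in> L"
      using e False by (intro subsetD[OF e(2)]) auto
    then have "((e / norm p) *\<^sub>R p) \<bullet> p \<le> 1"
      using that by (auto simp: polar_def)
    then have "e * norm p \<le> 1"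
      using False by (simp add: dot_square_norm power2_eq_square)
    then show ?thesis
      using e(1) by (simp add: field_simps)
  qed (use e in auto)
  then have "bounded (polar L)"
    by (auto simp: bounded_iff)
  moreover have "polar L = (\<Inter>x\<in>L. {p. x \<bullet> p \<le> 1})"
    by (auto simp: polar_def)
  then have "closed (polar L)"
    by (auto intro!: closed_INT closed_halfspace_le)
  ultimately show ?thesis
    by (simp add: compact_eq_bounded_closed)
qed

text \<open>This is the bipolar theorem, pointwise. A separating hyperplane has a negative level
  \<open>b\<close>, because the origin lies on the side of \<open>L\<close>; dividing by
  \<open>b\<close> normalises the level to 1 and reverses the inequalities.\<close>

lemma polar_separates:
  fixes L :: "'a::euclidean_space set"
  assumes "closed L" and "convex L" and "0 \<in> L" and "y \<notin> L"
  obtains p where "p \<in> polar L" and "p \<bullet> y > 1"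
proof -
  obtain a b where ab: "a \<bullet> y < b" "\<And>x. x \<in> L \<Longrightarrow> a \<bullet> x > b"
    using separating_hyperplane_closed_point[OF assms(2,1,4)] by blast
  have b: "b < 0"
    using ab(2)[OF assms(3)] by simp
  show thesis
  proof
    show "(1 / b) *\<^sub>R a \<in> polar L"
      using ab(2) b by (force simp: polar_def divide_le_eq inner_commute)
    show "((1 / b) *\<^sub>R a) \<bullet> y > 1"
      using ab(1) b by (simp add: less_divide_eq)
  qed
qed

text \<open>The interior of \<open>S\<close> lies in the open half-space
  \<open>a \<bullet> y < 1\<close>, whose bounding hyperplane contains \<open>x\<close>.\<close>

lemma support_point_in_frontier:
  fixes S :: "'a::euclidean_space set"
  assumes "x \<in> S" and "\<And>y. y \<in> S \<Longrightarrow> a \<bullet> y \<le> 1" and "a \<bullet> x = 1"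
  shows "x \<in> frontier S"
proof -
  have "interior S \<subseteq> interior {y. a \<bullet> y \<le> 1}"
    using assms(2) by (intro interior_mono) auto
  moreover have "a \<noteq> 0"
    using assms(3) by auto
  ultimately have "interior S \<subseteq> {y. a \<bullet> y < 1}"
    by (simp add: interior_halfspace_le)
  then have "x \<notin> interior S"
    using assms(3) by auto
  then show ?thesis
    using assms(1) closure_subset by (auto simp: frontier_def)
qed

text \<open>Once \<open>p \<bullet> v = 1\<close>, the vector \<open>p\<close> supports
  \<open>K\<close> and \<open>L\<close> at \<open>v\<close>, and \<open>v\<close> supports both
  polars at \<open>p\<close>, so all four frontier conditions follow. The resulting description is
  visibly closed under limits.\<close>

lemma contact_pair_iff:
  fixes K L :: "'a::euclidean_space set"
  assumes "closed K" and "K \<subseteq> L" and "0 \<in> interior L"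
  shows "contact_pair K L v p \<longleftrightarrow> v \<in> K \<and> p \<in> polar L \<and> p \<bullet> v = 1"
proof
  assume "contact_pair K L v p"
  moreover have "closed (polar L)"
    using compact_polar[OF assms(3)] by (rule compact_imp_closed)
  ultimately show "v \<in> K \<and> p \<in> polar L \<and> p \<bullet> v = 1"
    using assms(1) by (auto simp: contact_pair_def frontier_def closure_closed)
next
  assume *: "v \<in> K \<and> p \<in> polar L \<and> p \<bullet> v = 1"
  have "polar L \<subseteq> polar K"
    using assms(2) by (auto simp: polar_def)
  with * assms(2) have "v \<in> L" "p \<in> polar K"
    by auto
  have "v \<in> frontier K"
    by (rule support_point_in_frontier[of _ _ p])
      (use * \<open>p \<in> polar K\<close> in \<open>auto simp: polar_def inner_commute\<close>)
  moreover have "v \<in> frontier L"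
    by (rule support_point_in_frontier[of _ _ p])
      (use * \<open>v \<in> L\<close> in \<open>auto simp: polar_def inner_commute\<close>)
  moreover have "p \<in> frontier (polar K)"
    by (rule support_point_in_frontier[of _ _ v])
      (use * \<open>p \<in> polar K\<close> in \<open>auto simp: polar_def inner_commute\<close>)
  moreover have "p \<in> frontier (polar L)"
    by (rule support_point_in_frontier[of _ _ v])
      (use * \<open>v \<in> L\<close> in \<open>auto simp: polar_def inner_commute\<close>)
  ultimately show "contact_pair K L v p"
    using * by (simp add: contact_pair_def)
qed

text \<open>The Cayley transform \<open>R = (1 + t S) (1 - t S)\<^sup>-\<^sup>1\<close>, characterised without inverses.\<close>
lemma Cayley_transform:
  fixes S :: "'a::euclidean_space \<Rightarrow> 'a"
  assumes "linear S" and skew: "\<And>x y. S x \<bullet> y = - (x \<bullet> S y)"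
  obtains R where "orthogonal_transformation R" and "\<And>x. R x - x = t *\<^sub>R S (R x + x)"
proof -
  define P where "P = (\<lambda>x. x + t *\<^sub>R S x)"
  define Q where "Q = (\<lambda>x. x - t *\<^sub>R S x)"
  interpret S: linear S by fact
  have linP: "linear P" and linQ: "linear Q"
    unfolding P_def Q_def
    by (auto intro!: linearI simp: S.add S.scale algebra_simps)
  have S0: "x \<bullet> S x = 0" for x
    using skew[of x x] by (simp add: inner_commute)
  \<comment> \<open>Skewness removes the cross term, so \<open>P x\<close> and \<open>Q x\<close>
    both have squared norm \<open>x \<bullet> x + t\<^sup>2 * (S x \<bullet> S x)\<close>. Hence
    \<open>Q\<close> is invertible and \<open>P \<circ> Q'\<close> is an isometry.\<close>
  have normP: "norm (P x) = norm (Q x)" and normQ: "norm x \<le> norm (Q x)" for x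
  proof -
    have "P x \<bullet> P x = Q x \<bullet> Q x" "Q x \<bullet> Q x = x \<bullet> x + t\<^sup>2 * (S x \<bullet> S x)"
      by (simp_all add: P_def Q_def inner_add_left inner_add_right inner_diff_left inner_diff_right
          S0 inner_commute[of "S x" x] power2_eq_square)
    then show "norm (P x) = norm (Q x)" "norm x \<le> norm (Q x)"
      by (simp_all add: norm_eq_sqrt_inner)
  qed
  have "inj Q"
    unfolding linear_injective_0[OF linQ] using normQ by (metis norm_eq_zero norm_ge_zero order_antisym)
  then obtain Q' where Q': "linear Q'" "\<And>x. Q' (Q x) = x" "\<And>x. Q (Q' x) = x"
    using linear_injective_isomorphism[OF linQ] by blast
  show thesis
  proof
    show "orthogonal_transformation (P \<circ> Q')"
      unfolding orthogonal_transformation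
      using linear_compose[OF Q'(1) linP] by (simp add: normP Q'(3))
    fix x
    have "P y - Q y = t *\<^sub>R S (P y + Q y)" for y
      by (simp add: P_def Q_def S.add S.diff S.scale flip: scaleR_2)
    from this[of "Q' x"] show "(P \<circ> Q') x - x = t *\<^sub>R S ((P \<circ> Q') x + x)"
      by (simp add: Q'(3))
  qed
qed

lemma eventually_F_operator:
  fixes F :: "'a::euclidean_space set"
  assumes "subspace F" and "linear B" and "B ` F \<subseteq> F"
    and "\<And>x. x \<in> orthogonal_comp F \<Longrightarrow> B x = b *\<^sub>R x"
  shows "\<forall>\<^sub>F t in at_right 0. F_operator F (\<lambda>x. x + t *\<^sub>R B x)"
proof -
  interpret B: linear B by fact
  obtain C where C: "C > 0" "\<And>x. norm (B x) \<le> C * norm x"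
    using linear_bounded_pos[OF assms(2)] by blast
  \<comment> \<open>This bound forces \<open>t * C + t * \<bar>b\<bar> < 1\<close>: the first
    summand makes the perturbed identity injective, the second keeps its scalar
    \<open>1 + t * b\<close> on the complement nonzero.\<close>
  define r where "r = 1 / (C + \<bar>b\<bar>)"
  have r: "r > 0"
    using C(1) by (simp add: r_def)
  have "F_operator F (\<lambda>x. x + t *\<^sub>R B x)" if t: "0 < t" "t < r" for t
  proof -
    let ?A = "\<lambda>x. x + t *\<^sub>R B x"
    have "t * C + t * \<bar>b\<bar> < 1"
      using t C(1) by (simp add: r_def field_simps)
    moreover have "t * C > 0" "t * \<bar>b\<bar> = \<bar>t * b\<bar>"
      using t C(1) by (simp_all add: abs_mult)
    ultimately have tC: "t * C < 1" and tb: "1 + t * b > 0"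
      by linarith+
    have lin: "linear ?A"
      by (auto intro!: linearI simp: B.add B.scale algebra_simps)
    have "x = 0" if "?A x = 0" for x
    proof (rule ccontr)
      assume "x \<noteq> 0"
      have "norm x = norm (t *\<^sub>R B x)"
        using that by (metis add_eq_0_iff norm_minus_cancel)
      also have "\<dots> \<le> t * C * norm x"
        using t C(2)[of x] by (simp add: mult.assoc)
      also have "\<dots> < 1 * norm x"
        using tC \<open>x \<noteq> 0\<close> by (intro mult_strict_right_mono) auto
      finally show False by simp
    qed
    then have "inj ?A"
      unfolding linear_injective_0[OF lin] by blast
    then have "bij ?A"
      using linear_injective_imp_surjective[OF lin] by (simp add: bij_def)
    moreover have "?A ` F \<subseteq> F"
      using assms(1,3) by (auto intro!: subspace_add subspace_scale)
    moreover have A_perp: "?A x = (1 + t * b) *\<^sub>R x" if "x \<in> orthogonal_comp F" for x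
      using assms(4)[OF that] by (simp add: algebra_simps)
    moreover have "?A ` orthogonal_comp F \<subseteq> orthogonal_comp F"
      using subspace_scale[OF subspace_orthogonal_comp] A_perp by auto
    ultimately show ?thesis
      unfolding F_operator_def using lin tb by (intro conjI exI[of _ "1 + t * b"]) auto
  qed
  then show ?thesis
    unfolding eventually_at_right_field using r by blast
qed

text \<open>If containment failed for arbitrarily small \<open>t\<close>, there would be points of
  \<open>K\<close> pushed out of \<open>L\<close> and elements of the polar witnessing this. A
  subsequential limit of these is a contact pair at which the first-order term is nonnegative,
  against \<open>neg\<close>.\<close>

lemma eventually_perturbation_subset:
  fixes K L :: "'a::euclidean_space set" and R :: "real \<Rightarrow> 'a \<Rightarrow> 'a"
  assumes "compact K" and "closed L" and "convex L" and "0 \<in> interior L" and "K \<subseteq> L"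
    and "linear S" and "linear B"
    and R: "\<And>t. orthogonal_transformation (R t)" "\<And>t x. R t x - x = t *\<^sub>R S (R t x + x)"
    and neg: "\<And>v p. contact_pair K L v p \<Longrightarrow> p \<bullet> (2 *\<^sub>R S v + B v + w) < 0"
  shows "\<forall>\<^sub>F t in at_right 0. \<forall>x\<in>K. R t (x + t *\<^sub>R B x) + t *\<^sub>R w \<in> L"
proof (rule ccontr)
  assume not_ev: "\<not> ?thesis"
  have "0 \<in> L"
    using assms(4) interior_subset by blast
  have "\<exists>t x p. 0 < t \<and> t < 1 / real (Suc n) \<and> x \<in> K \<and> p \<in> polar L \<and>
      p \<bullet> (R t (x + t *\<^sub>R B x) + t *\<^sub>R w) > 1" for n
  proof -
    have "1 / real (Suc n) > 0"
      by simp
    then obtain t x where "0 < t" "t < 1 / real (Suc n)" "x \<in> K" "R t (x + t *\<^sub>R B x) + t *\<^sub>R w \<notin> L"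
      using not_ev unfolding eventually_at_right_field by blast
    then show ?thesis
      using polar_separates[OF assms(2,3) \<open>0 \<in> L\<close>] by metis
  qed
  then obtain t x p where t: "\<And>n. 0 < t n" "\<And>n. t n < 1 / real (Suc n)"
    and x: "\<And>n. x n \<in> K" and p: "\<And>n. p n \<in> polar L"
    and gt: "\<And>n. p n \<bullet> (R (t n) (x n + t n *\<^sub>R B (x n)) + t n *\<^sub>R w) > 1"
    by metis
  have "compact (K \<times> polar L)"
    by (intro compact_Times assms(1) compact_polar assms(4))
  then obtain vq r where vq: "vq \<in> K \<times> polar L" and r: "strict_mono r"
    and lim: "((\<lambda>n. (x n, p n)) \<circ> r) \<longlonglongrightarrow> vq"
    using x p unfolding compact_def by (metis (mono_tags, lifting) mem_Sigma_iff)
  define v q where "v = fst vq" and "q = snd vq"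
  have v: "v \<in> K" and q: "q \<in> polar L"
    using vq by (auto simp: v_def q_def)
  define t' x' p' where "t' = t \<circ> r" and "x' = x \<circ> r" and "p' = p \<circ> r"
  have x': "x' \<longlonglongrightarrow> v" and p': "p' \<longlonglongrightarrow> q"
    using tendsto_fst[OF lim] tendsto_snd[OF lim] by (simp_all add: o_def x'_def p'_def v_def q_def)
  have "t \<longlonglongrightarrow> 0"
    by (rule tendsto_sandwich[OF _ _ tendsto_const LIMSEQ_inverse_real_of_nat])
      (use t in \<open>auto intro!: always_eventually less_imp_le simp: inverse_eq_divide\<close>)
  then have t': "t' \<longlonglongrightarrow> 0"
    unfolding t'_def using r by (rule LIMSEQ_subseq_LIMSEQ)
  have contS: "isCont S a" and contB: "isCont B a" for a
    using assms(6,7) by (auto intro: linear_continuous_at simp: linear_conv_bounded_linear)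
  have Bx': "(\<lambda>n. B (x' n)) \<longlonglongrightarrow> B v"
    using isCont_tendsto_compose[OF contB x'] .
  define z where "z = (\<lambda>n. x' n + t' n *\<^sub>R B (x' n))"
  have z: "z \<longlonglongrightarrow> v"
    unfolding z_def using tendsto_add[OF x' tendsto_scaleR[OF t' Bx']] by simp
  define u where "u = (\<lambda>n. R (t' n) (z n))"
  \<comment> \<open>The Cayley identity gives an exact expansion in place of a Taylor estimate. As
    \<open>u\<close> and \<open>z\<close> both tend to \<open>v\<close>, its first-order term tends
    to \<open>2 *\<^sub>R S v\<close>.\<close>
  have u_eq: "u n = z n + t' n *\<^sub>R S (u n + z n)" for n
    using R(2)[of "t' n" "z n"] by (simp add: u_def algebra_simps)
  \<comment> \<open>Convergence of \<open>u\<close> is not yet known here; the isometry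
    \<open>R (t' n)\<close> bounds \<open>u n\<close> by the norm of \<open>z n\<close>, which
    suffices.\<close>
  have "(\<lambda>n. t' n *\<^sub>R S (u n + z n)) \<longlonglongrightarrow> 0"
  proof -
    obtain C where C: "C > 0" "\<And>x. norm (S x) \<le> C * norm x"
      using linear_bounded_pos[OF assms(6)] by blast
    have "norm (u n) = norm (z n)" for n
      using orthogonal_transformation_norm[OF R(1)] by (simp add: u_def)
    then have "norm (u n + z n) \<le> 2 * norm (z n)" for n
      using norm_triangle_ineq[of "u n" "z n"] by simp
    then have "norm (S (u n + z n)) \<le> C * (2 * norm (z n))" for n
      using C order_trans[OF C(2)] mult_left_mono[of _ _ C] by (metis less_imp_le)
    then have bound: "\<forall>n. norm (t' n *\<^sub>R S (u n + z n)) \<le> \<bar>t' n\<bar> * (C * (2 * norm (z n)))"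
      by (simp add: mult_left_mono)
    have "(\<lambda>n. \<bar>t' n\<bar> * (C * (2 * norm (z n)))) \<longlonglongrightarrow> \<bar>0\<bar> * (C * (2 * norm v))"
      by (intro tendsto_intros t' z)
    then have "(\<lambda>n. \<bar>t' n\<bar> * (C * (2 * norm (z n)))) \<longlonglongrightarrow> 0"
      by simp
    then show ?thesis
      by (rule Lim_null_comparison[OF always_eventually[OF bound]])
  qed
  from tendsto_add[OF z this] have u: "u \<longlonglongrightarrow> v"
    by (simp flip: u_eq)
  have Su: "(\<lambda>n. S (u n + z n)) \<longlonglongrightarrow> 2 *\<^sub>R S v"
    using isCont_tendsto_compose[OF contS tendsto_add[OF u z]] linear_add[OF assms(6)]
    by (simp add: scaleR_2)
  have gt': "p' n \<bullet> (u n + t' n *\<^sub>R w) > 1" for n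
    using gt[of "r n"] by (simp add: p'_def u_def z_def x'_def t'_def)
  \<comment> \<open>The moved point has pairing above 1 with \<open>p' n\<close>, the original point
    at most 1. The difference is \<open>t' n\<close> times the claimed quantity.\<close>
  have "p' n \<bullet> (S (u n + z n) + B (x' n) + w) > 0" for n
  proof -
    have "x' n \<bullet> p' n \<le> 1"
      using p[of "r n"] x[of "r n"] \<open>K \<subseteq> L\<close> by (auto simp: p'_def x'_def polar_def)
    then have "p' n \<bullet> x' n \<le> 1"
      by (simp add: inner_commute)
    moreover have "u n + t' n *\<^sub>R w = x' n + t' n *\<^sub>R (S (u n + z n) + B (x' n) + w)"
      using u_eq[of n] by (simp add: z_def algebra_simps)
    with gt'[of n] have "p' n \<bullet> x' n + t' n * (p' n \<bullet> (S (u n + z n) + B (x' n) + w)) > 1"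
      by (simp only: inner_add_right inner_scaleR_right)
    ultimately have "t' n * (p' n \<bullet> (S (u n + z n) + B (x' n) + w)) > 0"
      by linarith
    moreover have "t' n > 0"
      using t(1) by (simp add: t'_def)
    ultimately show ?thesis
      by (simp add: zero_less_mult_iff)
  qed
  moreover have "(\<lambda>n. p' n \<bullet> (S (u n + z n) + B (x' n) + w)) \<longlonglongrightarrow> q \<bullet> (2 *\<^sub>R S v + B v + w)"
    by (intro tendsto_intros p' Su Bx')
  ultimately have ge0: "q \<bullet> (2 *\<^sub>R S v + B v + w) \<ge> 0"
    by (intro LIMSEQ_le_const) (auto intro: less_imp_le)
  \<comment> \<open>In the limit the displacement vanishes, so \<open>q \<bullet> v\<close> is at
    least 1; membership in the polar gives equality, hence a contact pair.\<close>
  have "(\<lambda>n. p' n \<bullet> (u n + t' n *\<^sub>R w)) \<longlonglongrightarrow> q \<bullet> (v + 0 *\<^sub>R w)"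
    by (intro tendsto_intros p' u t')
  then have "q \<bullet> v \<ge> 1"
    using gt' by (intro LIMSEQ_le_const[of "\<lambda>n. p' n \<bullet> (u n + t' n *\<^sub>R w)"]) (auto intro: less_imp_le)
  moreover have "v \<bullet> q \<le> 1"
    using q v \<open>K \<subseteq> L\<close> by (auto simp: polar_def)
  ultimately have "contact_pair K L v q"
    using q v by (simp add: contact_pair_iff compact_imp_closed assms inner_commute)
  from neg[OF this] ge0 show False
    by simp
qed

section \<open>Volume growth and first-order optimality\<close>

lemma trace_op_matrix: "trace (op_matrix f) = op_trace f"
  using sum_basis_vec[of "\<lambda>b. f b \<bullet> b"] by (simp add: trace_def op_matrix_def op_trace_def)

text \<open>The determinant of \<open>1 + t B\<close> equals 1 at \<open>t = 0\<close> and has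
  derivative \<open>op_trace B > 0\<close> there, while \<open>R t\<close> and the translation
  preserve volume. The nonempty interior of \<open>K\<close> makes its volume positive, so the
  increase is strict.\<close>

lemma eventually_measure_less:
  fixes K :: "'a::euclidean_space set" and R :: "real \<Rightarrow> 'a \<Rightarrow> 'a"
  assumes "convex_body K" and "linear B" and "op_trace B > 0"
    and R: "\<And>t. orthogonal_transformation (R t)"
  shows "\<forall>\<^sub>F t in at_right 0. measure lebesgue K
    < measure lebesgue ((\<lambda>x. R t (x + t *\<^sub>R B x) + t *\<^sub>R w) ` K)"
proof -
  interpret B: linear B by fact
  have K: "compact K" "interior K \<noteq> {}"
    using assms(1) by (auto simp: convex_body_def)
  have "\<not> negligible (interior K)"
    using K(2) open_not_negligible by blast
  then have "\<not> negligible K"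
    using interior_subset negligible_subset by blast
  then have pos: "measure lebesgue K > 0"
    using K(1) by (simp add: negligible_iff_measure0 lmeasurable_compact zero_less_measure_iff
        less_le)
  obtain r where r: "r > 0" "\<And>t. 0 < t \<Longrightarrow> t < r \<Longrightarrow> 1 < det (mat 1 + t *\<^sub>R op_matrix B)"
    using DERIV_pos_inc_right[OF det_mat_1_add_derivative[of "op_matrix B"]] assms(3)
    by (auto simp: trace_op_matrix)
  have "measure lebesgue K < measure lebesgue ((\<lambda>x. R t (x + t *\<^sub>R B x) + t *\<^sub>R w) ` K)"
    if t: "0 < t" "t < r" for t
  proof -
    let ?A = "\<lambda>x. x + t *\<^sub>R B x"
    have lin: "linear ?A"
      by (auto intro!: linearI simp: B.add B.scale algebra_simps)
    have "op_matrix ?A = mat 1 + t *\<^sub>R op_matrix B"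
      by (auto simp: op_matrix_def mat_def vec_eq_iff inner_add_left inner_basis_vec)
    then have "measure lebesgue K < \<bar>det (op_matrix ?A)\<bar> * measure lebesgue K"
      using r(2)[OF t] pos by simp
    also have "\<dots> = measure lebesgue (R t ` ?A ` K)"
      by (simp add: measure_orthogonal_transformation_image[OF R] compact_image_linear[OF lin K(1)]
          measure_linear_image_det[OF lin K(1)])
    also have "\<dots> = measure lebesgue ((+) (t *\<^sub>R w) ` R t ` ?A ` K)"
      by (simp only: measure_translation)
    also have "(+) (t *\<^sub>R w) ` R t ` ?A ` K = (\<lambda>x. R t (?A x) + t *\<^sub>R w) ` K"
      by (simp add: image_image add.commute)
    finally show ?thesis .
  qed
  then show ?thesis
    unfolding eventually_at_right_field using r(1) by blast
qed

text \<open>First-order optimality: the trace is the derivative of the volume along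
  \<open>t \<mapsto> R t \<circ> (1 + t B)\<close>, where \<open>R t\<close> is the Cayley transform of \<open>S\<close>, tangent to \<open>2 S\<close> at \<open>t = 0\<close>.\<close>
lemma largest_position_no_ascent:
  fixes K L F :: "'a::euclidean_space set"
  assumes "convex_body K" and "convex_body L" and "0 \<in> interior L" and "K \<subseteq> L" and "subspace F"
    and max: "\<forall>K' \<in> rotated_positions F K. K' \<subseteq> L \<longrightarrow> measure lebesgue K' \<le> measure lebesgue K"
    and "linear S" and skew: "\<And>x y. S x \<bullet> y = - (x \<bullet> S y)"
    and "linear B" and "B ` F \<subseteq> F" and "\<And>x. x \<in> orthogonal_comp F \<Longrightarrow> B x = b *\<^sub>R x"
    and "op_trace B > 0"
  shows "\<exists>v p. contact_pair K L v p \<and> p \<bullet> (2 *\<^sub>R S v + B v + w) \<ge> 0"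
proof (rule ccontr)
  assume "\<not> ?thesis"
  then have neg: "p \<bullet> (2 *\<^sub>R S v + B v + w) < 0" if "contact_pair K L v p" for v p
    using that by (meson not_le)
  have "\<exists>R. orthogonal_transformation R \<and> (\<forall>x. R x - x = t *\<^sub>R S (R x + x))" for t
    using Cayley_transform[OF assms(7) skew] by metis
  then obtain R where R: "\<And>t. orthogonal_transformation (R t)"
      "\<And>t x. R t x - x = t *\<^sub>R S (R t x + x)"
    by metis
  have "\<forall>\<^sub>F t in at_right 0. \<forall>x\<in>K. R t (x + t *\<^sub>R B x) + t *\<^sub>R w \<in> L"
    using assms by (intro eventually_perturbation_subset[OF _ _ _ _ _ _ _ R neg])
      (auto simp: convex_body_def compact_imp_closed)
  moreover have "\<forall>\<^sub>F t in at_right 0. F_operator F (\<lambda>x. x + t *\<^sub>R B x)"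
    using assms by (intro eventually_F_operator)
  moreover have "\<forall>\<^sub>F t in at_right 0. measure lebesgue K
      < measure lebesgue ((\<lambda>x. R t (x + t *\<^sub>R B x) + t *\<^sub>R w) ` K)"
    using assms R(1) by (intro eventually_measure_less)
  ultimately have "\<forall>\<^sub>F t in at_right (0::real). False"
  proof eventually_elim
    case (elim t)
    have "(\<lambda>x. R t (x + t *\<^sub>R B x) + t *\<^sub>R w) ` K \<in> rotated_positions F K"
      unfolding rotated_positions_def mem_Collect_eq using R(1) elim(2)
      by (intro exI[of _ "R t"] exI[of _ "\<lambda>x. x + t *\<^sub>R B x"] exI[of _ "t *\<^sub>R w"]) simp
    moreover have "(\<lambda>x. R t (x + t *\<^sub>R B x) + t *\<^sub>R w) ` K \<subseteq> L"
      using elim(1) by auto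
    ultimately show False
      using max elim(3) by (meson not_le)
  qed
  then show False
    by simp
qed

subsection \<open>Orthogonal projection and duality\<close>

lemma orth_proj_eqI:
  fixes F :: "'a::euclidean_space set"
  assumes "subspace F" and "y \<in> F" and "x - y \<in> orthogonal_comp F"
  shows "orth_proj F x = y"
  unfolding orth_proj_def
proof (rule the_equality)
  fix z assume z: "z \<in> F \<and> x - z \<in> orthogonal_comp F"
  have "y - z \<in> F"
    using assms z by (simp add: subspace_diff)
  \<comment> \<open>The difference of two candidates lies in \<open>F\<close> and in its complement,
    so it is orthogonal to itself.\<close>
  moreover have "(x - z) - (x - y) \<in> orthogonal_comp F"
    using assms(3) z subspace_diff[OF subspace_orthogonal_comp] by blast
  ultimately have "(y - z) \<bullet> (y - z) = 0"
    by (simp add: orthogonal_comp_def orthogonal_def)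
  then show "z = y"
    by simp
qed (use assms in auto)

lemma orth_proj:
  fixes F :: "'a::euclidean_space set"
  assumes "subspace F"
  shows orth_proj_in: "orth_proj F x \<in> F"
    and orth_proj_diff: "x - orth_proj F x \<in> orthogonal_comp F"
proof -
  have "x \<in> F + orthogonal_comp F"
    using subspace_sum_orthogonal_comp[OF assms] by simp
  then obtain y z where "y \<in> F" "z \<in> orthogonal_comp F" "x = y + z"
    by (auto elim: set_plus_elim)
  with orth_proj_eqI[OF assms, of y x]
  show "orth_proj F x \<in> F" "x - orth_proj F x \<in> orthogonal_comp F"
    by simp_all
qed

lemma linear_orth_proj:
  fixes F :: "'a::euclidean_space set"
  assumes "subspace F"
  shows "linear (orth_proj F)"
proof (rule linearI)
  fix x y and c :: real
  have "(x - orth_proj F x) + (y - orth_proj F y) \<in> orthogonal_comp F"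
    "c *\<^sub>R (x - orth_proj F x) \<in> orthogonal_comp F"
    using subspace_add[OF subspace_orthogonal_comp] subspace_scale[OF subspace_orthogonal_comp]
      orth_proj_diff[OF assms] by blast+
  then show "orth_proj F (x + y) = orth_proj F x + orth_proj F y"
    "orth_proj F (c *\<^sub>R x) = c *\<^sub>R orth_proj F x"
    using assms orth_proj_in[OF assms]
    by (auto intro!: orth_proj_eqI subspace_add subspace_scale simp: algebra_simps)
qed

lemma orth_proj_perp:
  fixes F :: "'a::euclidean_space set"
  assumes "subspace F" and "x \<in> orthogonal_comp F"
  shows "orth_proj F x = 0"
  by (rule orth_proj_eqI[OF assms(1) subspace_0[OF assms(1)]]) (simp add: assms(2))

lemma orth_proj_idem:
  fixes F :: "'a::euclidean_space set"
  assumes "subspace F"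
  shows "orth_proj F (orth_proj F x) = orth_proj F x"
  using orth_proj_in[OF assms]
  by (intro orth_proj_eqI[OF assms]) (simp_all add: subspace_0[OF subspace_orthogonal_comp])

text \<open>Both sides equal the inner product of the two projections.\<close>

lemma orth_proj_self_adjoint:
  fixes F :: "'a::euclidean_space set"
  assumes "subspace F"
  shows "orth_proj F x \<bullet> y = x \<bullet> orth_proj F y"
proof -
  have *: "f \<bullet> (z - orth_proj F z) = 0" if "f \<in> F" for z f
    using orth_proj_diff[OF assms, of z] that
    by (auto simp: orthogonal_comp_def orthogonal_def)
  have "orth_proj F x \<bullet> y = orth_proj F x \<bullet> orth_proj F y"
    using *[OF orth_proj_in[OF assms], of x y] by (simp add: inner_diff_right)
  moreover have "orth_proj F y \<bullet> x = orth_proj F y \<bullet> orth_proj F x"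
    using *[OF orth_proj_in[OF assms], of y x] by (simp add: inner_diff_right)
  ultimately show ?thesis
    by (simp add: inner_commute)
qed

section \<open>Duality between contact pairs and infinitesimal moves\<close>

text \<open>The first two components pair with skew operators and with operators of the form \<open>P Y P\<close>;
  together with multiples of the identity these span the infinitesimal rotated positions.\<close>
definition contact_functional ::
  "'a::euclidean_space set \<Rightarrow> 'a \<Rightarrow> 'a \<Rightarrow>
    (real ^ 'a basis_index ^ 'a basis_index) \<times> (real ^ 'a basis_index ^ 'a basis_index) \<times> 'a" where
  "contact_functional F v p =
    (\<chi> i j. (p \<bullet> basis_vec i) * (v \<bullet> basis_vec j) - (v \<bullet> basis_vec i) * (p \<bullet> basis_vec j),
     \<chi> i j. (orth_proj F p \<bullet> basis_vec i) * (orth_proj F v \<bullet> basis_vec j),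
     p)"

text \<open>The components encode symmetry, the identity block on \<open>F\<close> and centering.
  Division by the dimension accounts for convex weights summing to 1 rather than to
  \<open>d\<close>. The trace condition has no component of its own: it follows from
  \<open>p \<bullet> v = 1\<close> at each contact pair.\<close>

definition contact_target ::
  "'a::euclidean_space set \<Rightarrow>
    (real ^ 'a basis_index ^ 'a basis_index) \<times> (real ^ 'a basis_index ^ 'a basis_index) \<times> 'a" where
  "contact_target F =
    (0, \<chi> i j. (orth_proj F (basis_vec j) \<bullet> basis_vec i) / real DIM('a), 0)"

text \<open>By \<open>contact_pair_iff\<close> the contact pairs form a closed subset of
  \<open>K \<times> polar L\<close>, and the functional is continuous. Compactness is what makes the
  convex hull closed, hence strictly separable from an outside point.\<close>

lemma compact_contact_functional:
  fixes K L F :: "'a::euclidean_space set"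
  assumes "compact K" and "K \<subseteq> L" and "0 \<in> interior L" and "subspace F"
  shows "compact ((\<lambda>(v, p). contact_functional F v p) ` {(v, p). contact_pair K L v p})"
proof (rule compact_continuous_image)
  have "{(v, p). contact_pair K L v p} = (K \<times> polar L) \<inter> {vp. snd vp \<bullet> fst vp = 1}"
    using assms by (auto simp: contact_pair_iff compact_imp_closed)
  moreover have "compact (K \<times> polar L)"
    using assms by (intro compact_Times compact_polar)
  moreover have "closed {vp :: 'a \<times> 'a. snd vp \<bullet> fst vp = 1}"
    by (intro closed_Collect_eq continuous_intros)
  ultimately show "compact {(v, p). contact_pair K L v p}"
    by (simp add: compact_Int_closed)
  have P: "continuous_on A (\<lambda>x. orth_proj F (f x))" if "continuous_on A f"
    for A and f :: "'a \<times> 'a \<Rightarrow> 'a"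
    using linear_orth_proj[OF assms(4)] that
    unfolding linear_conv_bounded_linear by (rule bounded_linear.continuous_on)
  show "continuous_on {(v, p). contact_pair K L v p} (\<lambda>(v, p). contact_functional F v p)"
    unfolding contact_functional_def split_def by (intro continuous_intros P)
qed

text \<open>The components of \<open>a\<close> are read as a skew operator, an operator living on
  \<open>F\<close> and a vector. The inequality at the target becomes the positive trace, the
  inequalities at contact pairs become the negative first-order terms.\<close>

lemma separating_operator:
  fixes F :: "'a::euclidean_space set"
  assumes F: "subspace F" and sep: "a \<bullet> contact_target F < c"
    and gt: "\<And>v p. contact_pair K L v p \<Longrightarrow> a \<bullet> contact_functional F v p > c"
  obtains S B b w where "linear S" and "\<And>x y. S x \<bullet> y = - (x \<bullet> S y)"
    and "linear B" and "B ` F \<subseteq> F" and "\<And>x. x \<in> orthogonal_comp F \<Longrightarrow> B x = b *\<^sub>R x"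
    and "op_trace B > 0"
    and "\<And>v p. contact_pair K L v p \<Longrightarrow> p \<bullet> (2 *\<^sub>R S v + B v + w) < 0"
proof -
  obtain X Y u where a: "a = (X, Y, u)"
    by (metis prod_cases3)
  let ?e = "basis_vec :: 'a basis_index \<Rightarrow> 'a"
  let ?P = "orth_proj F"
  \<comment> \<open>Pairing \<open>X\<close> with the antisymmetrised product of \<open>p\<close>
    and \<open>v\<close> gives \<open>p \<bullet> S v\<close>; this \<open>S\<close> is skew for
    every matrix \<open>X\<close>.\<close>
  define S where "S = (\<lambda>x. \<Sum>i\<in>UNIV. \<Sum>j\<in>UNIV.
    (X $ i $ j) *\<^sub>R ((x \<bullet> ?e j) *\<^sub>R ?e i - (x \<bullet> ?e i) *\<^sub>R ?e j))"
  define G where "G = (\<lambda>x. \<Sum>i\<in>UNIV. \<Sum>j\<in>UNIV. (Y $ i $ j * (?P x \<bullet> ?e j)) *\<^sub>R ?P (?e i))"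
  \<comment> \<open>The multiple of the identity absorbs the separation level:
    \<open>p \<bullet> v = 1\<close> gives \<open>p \<bullet> B v = c - p \<bullet> G v\<close>, and
    \<open>op_trace B\<close> is \<open>c\<close> times the dimension minus
    \<open>op_trace G\<close>.\<close>
  define B where "B = (\<lambda>x. c *\<^sub>R x - G x)"
  have linP: "?P (x + y) = ?P x + ?P y" "?P (r *\<^sub>R x) = r *\<^sub>R ?P x" for x y r
    using linear_orth_proj[OF F] by (simp_all add: linear_add linear_scale)
  have linS: "linear S"
    by (rule linearI) (simp_all add: S_def inner_add_left scaleR_sum_right algebra_simps
      sum.distrib sum_subtractf)
  have linG: "linear G"
    by (rule linearI) (simp_all add: G_def linP inner_add_left scaleR_sum_right algebra_simps sum.distrib)
  have linB: "linear B"
    by (rule linearI) (simp_all add: B_def linear_add[OF linG] linear_scale[OF linG] algebra_simps)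
  have inner_S: "S x \<bullet> y = (\<Sum>i\<in>UNIV. \<Sum>j\<in>UNIV.
      X $ i $ j * ((x \<bullet> ?e j) * (y \<bullet> ?e i) - (x \<bullet> ?e i) * (y \<bullet> ?e j)))" for x y
    by (simp add: S_def inner_sum_left inner_diff_left inner_commute[of "?e _" y])
  have skew: "S x \<bullet> y = - (x \<bullet> S y)" for x y
    unfolding inner_commute[of x] inner_S sum_negf[symmetric]
    by (intro sum.cong refl) (simp add: algebra_simps)
  have G_perp: "G x = 0" if "x \<in> orthogonal_comp F" for x
    using orth_proj_perp[OF F that] by (simp add: G_def)
  have G_in: "G x \<in> F" for x
    unfolding G_def using F by (intro subspace_sum subspace_scale orth_proj_in)
  have inner_G: "p \<bullet> G x = (\<Sum>i\<in>UNIV. \<Sum>j\<in>UNIV. Y $ i $ j * ((?P p \<bullet> ?e i) * (?P x \<bullet> ?e j)))" for p x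
    by (simp add: G_def inner_sum_right orth_proj_self_adjoint[OF F] orth_proj_idem[OF F] mult_ac)
  have trace_G: "op_trace G = (\<Sum>i\<in>UNIV. \<Sum>j\<in>UNIV. Y $ i $ j * (?P (?e j) \<bullet> ?e i))"
  proof -
    have "op_trace G = (\<Sum>b\<in>Basis. \<Sum>i\<in>UNIV. \<Sum>j\<in>UNIV. Y $ i $ j * ((b \<bullet> ?P (?e i)) * (b \<bullet> ?P (?e j))))"
      unfolding op_trace_def inner_commute[of "G _"] inner_G by (simp add: orth_proj_self_adjoint[OF F] orth_proj_idem[OF F])
    also have "\<dots> = (\<Sum>i\<in>UNIV. \<Sum>j\<in>UNIV. \<Sum>b\<in>Basis. Y $ i $ j * ((b \<bullet> ?P (?e i)) * (b \<bullet> ?P (?e j))))"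
      by (subst sum.swap) (intro sum.cong refl sum.swap)
    also have "\<dots> = (\<Sum>i\<in>UNIV. \<Sum>j\<in>UNIV. Y $ i $ j * (?P (?e j) \<bullet> ?P (?e i)))"
      by (subst euclidean_inner[of "?P _"]) (simp add: sum_distrib_left inner_commute mult_ac)
    finally show ?thesis
      by (simp add: orth_proj_self_adjoint[OF F] orth_proj_idem[OF F])
  qed
  have inner_target: "a \<bullet> contact_target F = op_trace G / real DIM('a)"
    by (simp add: a contact_target_def inner_vec_def trace_G sum_divide_distrib)
  have inner_functional: "a \<bullet> contact_functional F v p = p \<bullet> S v + p \<bullet> G v + u \<bullet> p" for v p
    unfolding inner_commute[of p "S v"] inner_S inner_G
    by (simp add: a contact_functional_def inner_vec_def mult_ac)
  show thesis
  proof
    \<comment> \<open>The factor 1/2 cancels the 2 in the Cayley tangent. The minus sign here, like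
      that in \<open>- u\<close>, turns the lower bound \<open>c\<close> into a negative first-order
      term.\<close>
    show "linear (\<lambda>x. (- 1 / 2) *\<^sub>R S x)"
      by (intro linear_compose_scale_right linS)
    show "(- 1 / 2) *\<^sub>R S x \<bullet> y = - (x \<bullet> (- 1 / 2) *\<^sub>R S y)" for x y
      by (simp add: skew[of x])
    show "linear B" by (fact linB)
    show "B ` F \<subseteq> F"
      using F G_in by (auto simp: B_def intro!: subspace_diff subspace_scale)
    show "B x = c *\<^sub>R x" if "x \<in> orthogonal_comp F" for x
      by (simp add: B_def G_perp[OF that])
    have "op_trace B = c * real DIM('a) - op_trace G"
      by (simp add: op_trace_def B_def inner_diff_left sum_subtractf inner_same_Basis mult.commute)
    then show "op_trace B > 0"
      using sep by (simp add: inner_target divide_less_eq)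
    show "p \<bullet> (2 *\<^sub>R ((- 1 / 2) *\<^sub>R S v) + B v + (- u)) < 0" if "contact_pair K L v p" for v p
    proof -
      have "p \<bullet> v = 1"
        using that by (simp add: contact_pair_def)
      then show ?thesis
        using gt[OF that] by (simp add: inner_functional B_def inner_diff_right inner_add_right inner_commute)
    qed
  qed
qed

text \<open>A strict separation of the target from the hull would yield a direction excluded by
  \<open>largest_position_no_ascent\<close>. The argument also covers an empty set of contact pairs,
  since that lemma asserts that a pair exists.\<close>

lemma contact_target_in_hull:
  fixes K L F :: "'a::euclidean_space set"
  assumes "convex_body K" and "convex_body L" and "0 \<in> interior L" and "K \<subseteq> L" and "subspace F"
    and max: "\<forall>K' \<in> rotated_positions F K. K' \<subseteq> L \<longrightarrow> measure lebesgue K' \<le> measure lebesgue K"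
  shows "contact_target F \<in> convex hull ((\<lambda>(v, p). contact_functional F v p) ` {(v, p). contact_pair K L v p})"
    (is "_ \<in> ?H")
proof (rule ccontr)
  assume "contact_target F \<notin> ?H"
  moreover have "closed ?H"
    using assms by (intro compact_imp_closed compact_convex_hull compact_contact_functional)
      (auto simp: convex_body_def)
  ultimately obtain a c where sep: "a \<bullet> contact_target F < c" "\<And>x. x \<in> ?H \<Longrightarrow> a \<bullet> x > c"
    using separating_hyperplane_closed_point[OF convex_convex_hull] by metis
  have "a \<bullet> contact_functional F v p > c" if "contact_pair K L v p" for v p
    using that by (intro sep(2) hull_inc) auto
  from separating_operator[OF assms(5) sep(1) this] obtain S B b w where
    "linear S" "\<And>x y. S x \<bullet> y = - (x \<bullet> S y)" "linear B" "B ` F \<subseteq> F"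
    "\<And>x. x \<in> orthogonal_comp F \<Longrightarrow> B x = b *\<^sub>R x" "op_trace B > 0"
    and neg: "\<And>v p. contact_pair K L v p \<Longrightarrow> p \<bullet> (2 *\<^sub>R S v + B v + w) < 0"
    by metis
  then have "\<exists>v p. contact_pair K L v p \<and> p \<bullet> (2 *\<^sub>R S v + B v + w) \<ge> 0"
    using assms by (intro largest_position_no_ascent[of K L F S B b]) auto
  with neg show False
    by (meson not_le)
qed

section \<open>From hull membership to the weighted decomposition\<close>

lemma convex_hull_image_indexed:
  assumes "x \<in> convex hull (f ` A)"
  obtains m :: nat and a :: "nat \<Rightarrow> 'b" and u :: "nat \<Rightarrow> real"
  where "\<And>i. i < m \<Longrightarrow> a i \<in> A" and "\<And>i. i < m \<Longrightarrow> u i > 0"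
    and "(\<Sum>i<m. u i) = 1" and "(\<Sum>i<m. u i *\<^sub>R f (a i)) = x"
proof -
  obtain T w where T: "finite T" "T \<subseteq> f ` A" "\<forall>y\<in>T. 0 \<le> w y" "sum w T = 1" "(\<Sum>y\<in>T. w y *\<^sub>R y) = x"
    using assms unfolding convex_hull_explicit by blast
  \<comment> \<open>Points of weight zero are dropped because the final weights must be strictly
    positive.\<close>
  define T' where "T' = {y \<in> T. w y \<noteq> 0}"
  have "finite T'"
    using T(1) by (simp add: T'_def)
  then obtain h where h: "bij_betw h {..<card T'} T'"
    using ex_bij_betw_nat_finite by (metis atLeast0LessThan)
  have hT': "h i \<in> T'" if "i < card T'" for i
    using h that by (auto simp: bij_betw_def)
  show thesis
  proof
    have "h i \<in> f ` A" if "i < card T'" for i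
      using hT'[OF that] T(2) by (auto simp: T'_def)
    then show "inv_into A f (h i) \<in> A" if "i < card T'" for i
      using that by (simp add: inv_into_into)
    have fh: "f (inv_into A f (h i)) = h i" if "i < card T'" for i
      using \<open>\<And>i. i < card T' \<Longrightarrow> h i \<in> f ` A\<close> that by (simp add: f_inv_into_f)
    show "(w \<circ> h) i > 0" if "i < card T'" for i
      using hT'[OF that] T(3) by (auto simp: T'_def less_le)
    have "(\<Sum>i<card T'. (w \<circ> h) i) = sum w T'"
      using sum.reindex_bij_betw[OF h, of w] by simp
    also have "\<dots> = sum w T"
      using T(1) by (intro sum.mono_neutral_left) (auto simp: T'_def)
    finally show "(\<Sum>i<card T'. (w \<circ> h) i) = 1"
      using T(4) by simp
    have "(\<Sum>i<card T'. (w \<circ> h) i *\<^sub>R f (inv_into A f (h i))) = (\<Sum>i<card T'. w (h i) *\<^sub>R h i)"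
      by (simp add: fh)
    also have "\<dots> = (\<Sum>y\<in>T'. w y *\<^sub>R y)"
      by (rule sum.reindex_bij_betw[OF h])
    also have "\<dots> = (\<Sum>y\<in>T. w y *\<^sub>R y)"
      using T(1) by (intro sum.mono_neutral_left) (auto simp: T'_def)
    finally show "(\<Sum>i<card T'. (w \<circ> h) i *\<^sub>R f (inv_into A f (h i))) = x"
      using T(5) by simp
  qed
qed

lemma euclidean_eq_basis_vecI:
  assumes "\<And>i. x \<bullet> basis_vec i = y \<bullet> basis_vec i"
  shows "x = y"
proof -
  have "coords x = coords y"
    by (simp add: coords_def assms)
  then show ?thesis
    by (metis of_coords_coords)
qed

lemma linear_eq_basis_vecI:
  assumes "linear f" and "linear g" and "\<And>i. f (basis_vec i) = g (basis_vec i)"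
  shows "f = g"
proof (rule linear_eq_stdbasis[OF assms(1,2)])
  fix b :: 'a assume "b \<in> Basis"
  then show "f b = g b"
    using bij_betw_basis_vec assms(3) by (metis bij_betw_imp_surj_on imageE)
qed

theorem mainTheorem3:
  fixes K L F :: "'a::euclidean_space set"
  assumes "convex_body K" and "convex_body L"
    and "0 \<in> interior K" and "0 \<in> interior L"
    and "K \<subseteq> L"
    and "subspace F"
    and "\<forall>K' \<in> rotated_positions F K. K' \<subseteq> L \<longrightarrow>
           measure lebesgue K' \<le> measure lebesgue K"
  shows "\<exists>(m::nat) (v::nat \<Rightarrow> 'a) (p::nat \<Rightarrow> 'a) (\<alpha>::nat \<Rightarrow> real).
           (\<forall>i<m. contact_pair K L (v i) (p i) \<and> \<alpha> i > 0) \<and>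
           (let M = (\<lambda>x. \<Sum>i<m. \<alpha> i *\<^sub>R tensor (p i) (v i) x) in
              orth_proj F \<circ> M \<circ> orth_proj F = orth_proj F \<and>
              (\<Sum>i<m. \<alpha> i *\<^sub>R p i) = 0 \<and>
              op_trace M = (\<Sum>i<m. \<alpha> i) \<and>
              (\<Sum>i<m. \<alpha> i) = real DIM('a) \<and>
              M = (\<lambda>x. \<Sum>i<m. \<alpha> i *\<^sub>R tensor (v i) (p i) x))"
proof -
  let ?e = "basis_vec :: 'a basis_index \<Rightarrow> 'a"
  let ?P = "orth_proj F"
  let ?d = "real DIM('a)"
  have P: "linear ?P"
    using assms(6) by (rule linear_orth_proj)
  obtain m :: nat and c :: "nat \<Rightarrow> 'a \<times> 'a" and u :: "nat \<Rightarrow> real"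
    where c: "\<And>i. i < m \<Longrightarrow> c i \<in> {(v, p). contact_pair K L v p}"
      and u: "\<And>i. i < m \<Longrightarrow> u i > 0" "(\<Sum>i<m. u i) = 1"
      and target: "(\<Sum>i<m. u i *\<^sub>R (\<lambda>(v, p). contact_functional F v p) (c i)) = contact_target F"
    using convex_hull_image_indexed[OF contact_target_in_hull[OF assms(1,2,4-7)]] by blast
  \<comment> \<open>Scaling by the dimension raises the total weight from 1 to \<open>d\<close> and
    cancels the denominator in \<open>contact_target\<close>.\<close>
  define v p \<alpha> where "v = fst \<circ> c" and "p = snd \<circ> c" and "\<alpha> = (\<lambda>i. ?d * u i)"
  have contact: "contact_pair K L (v i) (p i)" if "i < m" for i
    using c[OF that] by (auto simp: v_def p_def)
  have "(\<Sum>i<m. \<alpha> i *\<^sub>R contact_functional F (v i) (p i)) = ?d *\<^sub>R contact_target F"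
    unfolding target[symmetric] by (simp add: scaleR_sum_right \<alpha>_def v_def p_def split_def)
  then have skew_part: "fst (\<Sum>i<m. \<alpha> i *\<^sub>R contact_functional F (v i) (p i)) = 0"
    and F_part: "fst (snd (\<Sum>i<m. \<alpha> i *\<^sub>R contact_functional F (v i) (p i)))
      = (\<chi> k l. ?P (?e l) \<bullet> ?e k)"
    and p_part: "snd (snd (\<Sum>i<m. \<alpha> i *\<^sub>R contact_functional F (v i) (p i))) = 0"
    by (simp_all add: contact_target_def vec_eq_iff)
  have sum_p: "(\<Sum>i<m. \<alpha> i *\<^sub>R p i) = 0"
    using p_part by (simp add: snd_sum contact_functional_def)
  \<comment> \<open>Vanishing of the antisymmetric component says that the matrix of the weighted
    operator is symmetric.\<close>
  have skew: "(\<Sum>i<m. \<alpha> i * ((p i \<bullet> ?e k) * (v i \<bullet> ?e l))) = (\<Sum>i<m. \<alpha> i * ((v i \<bullet> ?e k) * (p i \<bullet> ?e l)))" for k l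
    using arg_cong[OF skew_part, of "\<lambda>X. X $ k $ l"]
    by (simp add: fst_sum contact_functional_def right_diff_distrib sum_subtractf)
  have F_block: "(\<Sum>i<m. \<alpha> i * ((?P (p i) \<bullet> ?e k) * (?P (v i) \<bullet> ?e l))) = ?P (?e l) \<bullet> ?e k" for k l
    using arg_cong[OF F_part, of "\<lambda>X. X $ k $ l"]
    by (simp add: fst_sum snd_sum contact_functional_def)
  define M where "M = (\<lambda>x. \<Sum>i<m. \<alpha> i *\<^sub>R tensor (p i) (v i) x)"
  have linM: "linear M" and linMt: "linear (\<lambda>x. \<Sum>i<m. \<alpha> i *\<^sub>R tensor (v i) (p i) x)"
    unfolding M_def by (rule linearI; simp add: tensor_def inner_add_right algebra_simps sum.distrib scaleR_sum_right)+
  have "M = (\<lambda>x. \<Sum>i<m. \<alpha> i *\<^sub>R tensor (v i) (p i) x)"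
  proof (rule linear_eq_basis_vecI[OF linM linMt], rule euclidean_eq_basis_vecI)
    fix k l
    show "M (?e l) \<bullet> ?e k = (\<Sum>i<m. \<alpha> i *\<^sub>R tensor (v i) (p i) (?e l)) \<bullet> ?e k"
      using skew[of k l] by (simp add: M_def tensor_def inner_sum_left mult_ac)
  qed
  moreover have "?P \<circ> M \<circ> ?P = ?P"
  proof (rule linear_eq_basis_vecI, rule linear_compose[OF P linear_compose[OF linM P], unfolded comp_assoc[symmetric]],
      rule P, rule euclidean_eq_basis_vecI)
    fix k l
    \<comment> \<open>Self-adjointness moves the projections onto the vectors \<open>p i\<close> and
      \<open>v i\<close>, which gives the sum in \<open>F_block\<close>.\<close>
    have "(?P \<circ> M \<circ> ?P) (?e l) \<bullet> ?e k = M (?P (?e l)) \<bullet> ?P (?e k)"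
      by (simp add: orth_proj_self_adjoint[OF assms(6)])
    also have "\<dots> = (\<Sum>i<m. \<alpha> i * ((?P (p i) \<bullet> ?e k) * (?P (v i) \<bullet> ?e l)))"
      by (simp add: M_def tensor_def inner_sum_left orth_proj_self_adjoint[OF assms(6)] mult_ac)
    finally show "(?P \<circ> M \<circ> ?P) (?e l) \<bullet> ?e k = ?P (?e l) \<bullet> ?e k"
      by (simp only: F_block)
  qed
  moreover have sum_\<alpha>: "(\<Sum>i<m. \<alpha> i) = ?d"
    using u(2) by (simp add: \<alpha>_def flip: sum_distrib_left)
  moreover have "op_trace M = (\<Sum>i<m. \<alpha> i)"
  proof -
    \<comment> \<open>Each tensor has trace \<open>p i \<bullet> v i\<close>, which is 1 for a
      contact pair.\<close>
    have "op_trace M = (\<Sum>b\<in>Basis. \<Sum>i<m. \<alpha> i * ((p i \<bullet> b) * (v i \<bullet> b)))"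
      by (simp add: op_trace_def M_def tensor_def inner_sum_left mult_ac)
    also have "\<dots> = (\<Sum>i<m. \<alpha> i * (p i \<bullet> v i))"
      by (subst sum.swap) (simp add: euclidean_inner[of "p _" "v _"] sum_distrib_left)
    also have "\<dots> = (\<Sum>i<m. \<alpha> i)"
      using contact by (intro sum.cong) (auto simp: contact_pair_def)
    finally show ?thesis .
  qed
  moreover have "\<forall>i<m. contact_pair K L (v i) (p i) \<and> \<alpha> i > 0"
    using contact u(1) by (simp add: \<alpha>_def)
  ultimately show ?thesis
    using sum_p unfolding M_def Let_def by blast
qed

end
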